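(* Let $N\ge2$ be even, let $\omega\in\mathbb{C}$ with $|\omega|=1$, and let $a_0,\dots,a_{N-1}\in\mathbb{C}$ with $|a_n|<1$ for all $n$. Let $\mathcal{M}_1,\mathcal{M}_2$ be the CMV factors of size $N+1$ built from $(a_n)_{n=0}^{N-1}$ and $\omega$, and let $\hat{\mathcal{M}}_1,\hat{\mathcal{M}}_2$ be built in the same way from the mirror dual coefficients $\hat a_n=-\omega\,\overline{a_{N-n-1}}$, $n=0,\dots,N-1$, and the same $\omega$. Put $\mathcal{U}=\mathcal{M}_2\mathcal{M}_1$ and $\hat{\mathcal{U}}=\hat{\mathcal{M}}_2\hat{\mathcal{M}}_1$. Then, with $\tau=\omega^{1/2}$ (any fixed square root), $$\hat{\mathcal{M}}_2=Q_N(\tau^{-1})\,\mathcal{M}_1\,Q_N(\tau^{-1}),\qquad \hat{\mathcal{M}}_1=Q_N(\tau)\,\mathcal{M}_2\,Q_N(\tau),$$ and $$Q_N(\tau)\,\mathcal{U}\,Q_N(\tau^{-1})=\hat{\mathcal{M}}_1\hat{\mathcal{M}}_2=\hat{\mathcal{U}}^{T}.$$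
   Context: Put $\rho_k=\sqrt{1-|a_k|^2}$ and $\Theta_k=\begin{pmatrix}\overline{a_k}&\rho_k\\ \rho_k&-a_k\end{pmatrix}$. For even $N$ the CMV factors are the block-diagonal $(N+1)\times(N+1)$ matrices $$\mathcal{M}_1=(1)\oplus\Theta_1\oplus\Theta_3\oplus\dots\oplus\Theta_{N-1},\qquad \mathcal{M}_2=\Theta_0\oplus\Theta_2\oplus\dots\oplus\Theta_{N-2}\oplus(\omega^{-1}).$$ For $|\tau|=1$, the quasi-reflection matrix $Q_N(\tau)$ is the $(N+1)\times(N+1)$ matrix (rows and columns indexed by $0,\dots,N$) whose only nonzero entries are on the main antidiagonal, with entry $\tau^{(-1)^k}$ in position $(k,N-k)$, i.e. alternating $\tau,\tau^{-1},\tau,\dots$ starting with $\tau$ in the top right corner. $T$ denotes transposition. *)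

theory Defs
  imports Complex_Main "Jordan_Normal_Form.Matrix"
begin

definition rho :: "complex \<Rightarrow> complex" where
  "rho z = complex_of_real (sqrt (1 - (cmod z)\<^sup>2))"

definition Theta :: "complex \<Rightarrow> complex mat" where
  "Theta z = mat_of_rows_list 2 [[cnj z, rho z], [rho z, - z]]"

text \<open>The CMV factors of size \<open>N + 1\<close>, meant for even \<open>N\<close>: with \<open>n = N div 2\<close> they are
  \<open>1 \<oplus> Theta (a 1) \<oplus> Theta (a 3) \<oplus> \<dots> \<oplus> Theta (a (2 n - 1))\<close> and
  \<open>Theta (a 0) \<oplus> Theta (a 2) \<oplus> \<dots> \<oplus> Theta (a (2 n - 2)) \<oplus> inverse \<omega>\<close>.\<close>

definition cmv_M1 :: "nat \<Rightarrow> (nat \<Rightarrow> complex) \<Rightarrow> complex mat" where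
  "cmv_M1 N a = diag_block_mat (1\<^sub>m 1 # map (\<lambda>j. Theta (a (2 * j + 1))) [0..<N div 2])"

definition cmv_M2 :: "nat \<Rightarrow> complex \<Rightarrow> (nat \<Rightarrow> complex) \<Rightarrow> complex mat" where
  "cmv_M2 N \<omega> a =
     diag_block_mat (map (\<lambda>j. Theta (a (2 * j))) [0..<N div 2] @ [inverse \<omega> \<cdot>\<^sub>m 1\<^sub>m 1])"

definition cmv_U :: "nat \<Rightarrow> complex \<Rightarrow> (nat \<Rightarrow> complex) \<Rightarrow> complex mat" where
  "cmv_U N \<omega> a = cmv_M2 N \<omega> a * cmv_M1 N a"

text \<open>Only the values at \<open>n < N\<close> are meaningful: beyond that the subtraction truncates.\<close>

definition mirror_dual :: "nat \<Rightarrow> complex \<Rightarrow> (nat \<Rightarrow> complex) \<Rightarrow> nat \<Rightarrow> complex" where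
  "mirror_dual N \<omega> a n = - \<omega> * cnj (a (N - n - 1))"

definition quasi_refl :: "nat \<Rightarrow> complex \<Rightarrow> complex mat" where
  "quasi_refl N \<tau> =
     mat (N + 1) (N + 1) (\<lambda>(k, l). if l = N - k then \<tau> powi ((- 1) ^ k) else 0)"

end

theory Submission imports Defs begin

text \<open>Conjugation by the quasi-reflection reverses the order of rows and columns and multiplies the
  entry at \<open>(k, l)\<close> by \<open>\<tau>\<close> to the power \<open>(-1)^k + (-1)^l\<close>, that is by \<open>\<tau>\<^sup>2\<close>, \<open>1\<close> or \<open>\<tau>\<^sup>-\<^sup>2\<close>.
  As \<open>N\<close> is even, the reversal moves the scalar block from one end to the other and so interchanges
  the shapes of the two factors, while the powers \<open>\<tau>\<^sup>2 = \<omega>\<close> on the diagonal turn \<open>a\<close> into its mirror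
  dual. This entrywise comparison is made for the first equation only; the second is the first one
  for the dual coefficients, the mirror dual being an involution. The last two follow because the two quasi-reflections are mutually inverse and
  both factors are symmetric.\<close>

section \<open>Block diagonals with square blocks of one size\<close>

lemma diag_block_mat_carrier_uniform:
  assumes "\<And>A. A \<in> set As \<Longrightarrow> A \<in> carrier_mat m m"
  shows "diag_block_mat As \<in> carrier_mat (m * length As) (m * length As)"
proof -
  have "sum_list (map dim_row As) = m * length As" "sum_list (map dim_col As) = m * length As"
    using assms by (induction As) auto
  then show ?thesis
    by (intro carrier_matI) (simp_all add: dim_diag_block_mat)
qed

text \<open>With a common block size \<open>m\<close>, the quotient by \<open>m\<close> selects the
  block and the remainder the place inside it. Splitting off the first block shifts both indices by
  \<open>m\<close>, which lowers both quotients by one and keeps the remainders; this drives the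
  induction.\<close>

lemma index_diag_block_mat_uniform:
  assumes "\<And>A. A \<in> set As \<Longrightarrow> A \<in> carrier_mat m m"
    and "i < m * length As" and "j < m * length As"
  shows "diag_block_mat As $$ (i, j) =
    (if i div m = j div m then As ! (i div m) $$ (i mod m, j mod m) else 0)"
  using assms
proof (induction As arbitrary: i j)
  case Nil
  then show ?case by simp
next
  case (Cons A As)
  have m: "m > 0" using Cons.prems(2) by (cases m) auto
  have A: "A \<in> carrier_mat m m" using Cons.prems(1) by simp
  have dims: "diag_block_mat As \<in> carrier_mat (m * length As) (m * length As)"
    using Cons.prems(1) by (intro diag_block_mat_carrier_uniform) simp
  have IH: "diag_block_mat As $$ (i - m, j - m) =
      (if (i - m) div m = (j - m) div m
       then As ! ((i - m) div m) $$ ((i - m) mod m, (j - m) mod m) else 0)"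
    if "m \<le> i" "m \<le> j"
    using Cons.prems that by (intro Cons.IH) auto
  show ?case
    by (cases "i < m"; cases "j < m")
      (use carrier_matD[OF A] Cons.prems(2,3) m carrier_matD[OF dims] IH in
        \<open>auto simp: Let_def le_div_geq le_mod_geq not_less\<close>)
qed

section \<open>Entries and symmetry of the CMV factors\<close>

lemma Theta_carrier [simp]: "Theta z \<in> carrier_mat 2 2"
  by (auto simp: Theta_def mat_of_rows_list_def)

lemma index_Theta:
  assumes "r < 2" and "s < 2"
  shows "Theta z $$ (r, s) =
    (if r = s then (if r = 0 then cnj z else - z) else rho z)"
  using assms by (auto simp: Theta_def mat_of_rows_list_def less_2_cases_iff)

lemma diag_block_Theta_carrier:
  "diag_block_mat (map (\<lambda>j. Theta (f j)) [0..<n]) \<in> carrier_mat (2 * n) (2 * n)"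
proof -
  have "diag_block_mat (map (\<lambda>j. Theta (f j)) [0..<n])
      \<in> carrier_mat (2 * length (map (\<lambda>j. Theta (f j)) [0..<n]))
          (2 * length (map (\<lambda>j. Theta (f j)) [0..<n]))"
    by (rule diag_block_mat_carrier_uniform) auto
  then show ?thesis by simp
qed

lemma index_diag_block_Theta:
  assumes "i < 2 * n" and "j < 2 * n"
  shows "diag_block_mat (map (\<lambda>j. Theta (f j)) [0..<n]) $$ (i, j) =
    (if i div 2 = j div 2 then
       if i = j then (if even i then cnj (f (i div 2)) else - f (i div 2)) else rho (f (i div 2))
     else 0)"
proof -
  have *: "i mod 2 = j mod 2 \<longleftrightarrow> i = j" if "i div 2 = j div 2"
    using that by (metis div_mult_mod_eq)
  have "i div 2 < n" using assms(1) by auto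
  then show ?thesis
    using assms by (subst index_diag_block_mat_uniform[of _ 2])
      (auto simp: index_Theta * even_iff_mod_2_eq_zero)
qed

lemma cmv_M1_carrier: "even N \<Longrightarrow> cmv_M1 N a \<in> carrier_mat (N + 1) (N + 1)"
  using diag_block_Theta_carrier[of "\<lambda>j. a (2 * j + 1)" "N div 2"]
  by (auto simp: cmv_M1_def Let_def)

lemma cmv_M2_carrier: "even N \<Longrightarrow> cmv_M2 N \<omega> a \<in> carrier_mat (N + 1) (N + 1)"
  using diag_block_Theta_carrier[of "\<lambda>j. a (2 * j)" "N div 2"]
  by (auto simp: cmv_M2_def Let_def diag_block_mat_last)

text \<open>The leading scalar shifts the blocks by one row, so \<open>Theta (a i)\<close> occupies
  rows \<open>i\<close> and \<open>i + 1\<close> for odd \<open>i\<close>. An even row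
  \<open>i > 0\<close> is therefore the second row of a block and refers to
  \<open>a (i - 1)\<close>.\<close>

lemma index_cmv_M1:
  assumes "even N" and "i \<le> N" and "j \<le> N"
  shows "cmv_M1 N a $$ (i, j) =
    (if i = j then (if i = 0 then 1 else if odd i then cnj (a i) else - a (i - 1))
     else if odd i \<and> j = i + 1 then rho (a i)
     else if odd j \<and> i = j + 1 then rho (a j) else 0)"
proof -
  let ?B = "diag_block_mat (map (\<lambda>j. Theta (a (2 * j + 1))) [0..<N div 2])"
  have B: "?B \<in> carrier_mat N N"
    using diag_block_Theta_carrier[of "\<lambda>j. a (2 * j + 1)" "N div 2"] assms(1) by simp
  have "cmv_M1 N a $$ (i, j) =
      (if i = 0 \<or> j = 0 then if i = j then 1 else 0 else ?B $$ (i - 1, j - 1))"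
    using B assms by (auto simp: cmv_M1_def Let_def)
  also have "\<dots> = (if i = j then (if i = 0 then 1 else if odd i then cnj (a i) else - a (i - 1))
     else if odd i \<and> j = i + 1 then rho (a i)
     else if odd j \<and> i = j + 1 then rho (a j) else 0)"
  proof (cases "i = 0 \<or> j = 0")
    case False
    then obtain i' j' where ij: "i = Suc i'" "j = Suc j'"
      by (metis not0_implies_Suc)
    have "i' < 2 * (N div 2)" "j' < 2 * (N div 2)" using assms ij by auto
    note ix = index_diag_block_Theta[OF this, of "\<lambda>j. a (2 * j + 1)"]
    show ?thesis
      unfolding ij diff_Suc_1 ix
      by (cases "even i'"; cases "even j'") (auto elim!: evenE oddE)
  qed auto
  finally show ?thesis .
qed

text \<open>Here the scalar comes last, so blocks begin at even rows and the parities are opposite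
  to those in \<open>index_cmv_M1\<close>.\<close>

lemma index_cmv_M2:
  assumes "even N" and "i \<le> N" and "j \<le> N"
  shows "cmv_M2 N \<omega> a $$ (i, j) =
    (if i = j then (if i = N then inverse \<omega> else if even i then cnj (a i) else - a (i - 1))
     else if even i \<and> j = i + 1 then rho (a i)
     else if even j \<and> i = j + 1 then rho (a j) else 0)"
proof -
  let ?B = "diag_block_mat (map (\<lambda>j. Theta (a (2 * j))) [0..<N div 2])"
  have B: "?B \<in> carrier_mat N N"
    using diag_block_Theta_carrier[of "\<lambda>j. a (2 * j)" "N div 2"] assms(1) by simp
  have "cmv_M2 N \<omega> a $$ (i, j) =
      (if i = N \<or> j = N then if i = j then inverse \<omega> else 0 else ?B $$ (i, j))"
    using B assms by (auto simp: cmv_M2_def Let_def diag_block_mat_last)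
  also have "\<dots> =
    (if i = j then (if i = N then inverse \<omega> else if even i then cnj (a i) else - a (i - 1))
     else if even i \<and> j = i + 1 then rho (a i)
     else if even j \<and> i = j + 1 then rho (a j) else 0)"
  proof (cases "i = N \<or> j = N")
    case True
    then show ?thesis using assms by auto
  next
    case False
    then have "i < 2 * (N div 2)" "j < 2 * (N div 2)" using assms by auto
    note ix = index_diag_block_Theta[OF this, of "\<lambda>j. a (2 * j)"]
    show ?thesis
      using False unfolding ix
      by (cases "even i"; cases "even j") (auto elim!: evenE oddE)
  qed
  finally show ?thesis .
qed

lemma transpose_cmv_M1: "even N \<Longrightarrow> transpose_mat (cmv_M1 N a) = cmv_M1 N a"
  using cmv_M1_carrier[of N a] by (intro eq_matI) (auto simp: index_cmv_M1)

lemma transpose_cmv_M2: "even N \<Longrightarrow> transpose_mat (cmv_M2 N \<omega> a) = cmv_M2 N \<omega> a"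
  using cmv_M2_carrier[of N \<omega> a] by (intro eq_matI) (auto simp: index_cmv_M2)

section \<open>Multiplication by quasi-reflections\<close>

lemma quasi_refl_carrier [simp]: "quasi_refl N \<tau> \<in> carrier_mat (N + 1) (N + 1)"
  by (simp add: quasi_refl_def)

lemma index_quasi_refl_mult:
  assumes "M \<in> carrier_mat (N + 1) m" and "k \<le> N" and "l < m"
  shows "(quasi_refl N \<sigma> * M) $$ (k, l) = \<sigma> powi ((- 1) ^ k) * M $$ (N - k, l)"
proof -
  have "(quasi_refl N \<sigma> * M) $$ (k, l) =
      (\<Sum>i\<in>{0..<N + 1}. (if i = N - k then \<sigma> powi ((- 1) ^ k) else 0) * M $$ (i, l))"
    using assms by (simp add: quasi_refl_def scalar_prod_def)
  also have "\<dots> = (\<Sum>i\<in>{0..<N + 1}. if i = N - k then \<sigma> powi ((- 1) ^ k) * M $$ (i, l) else 0)"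
    by (intro sum.cong) auto
  finally show ?thesis by (simp add: sum.delta)
qed

text \<open>The only entry in column \<open>l\<close> of the quasi-reflection that can be nonzero
  lies in row \<open>N - l\<close>, so the exponent depends on the parity of \<open>N - l\<close>,
  whereas multiplication from the left involves that of \<open>k\<close>.\<close>

lemma index_mult_quasi_refl:
  assumes "M \<in> carrier_mat m (N + 1)" and "k < m" and "l \<le> N"
  shows "(M * quasi_refl N \<sigma>) $$ (k, l) = M $$ (k, N - l) * \<sigma> powi ((- 1) ^ (N - l))"
proof -
  have "(M * quasi_refl N \<sigma>) $$ (k, l) =
      (\<Sum>i\<in>{0..<N + 1}. M $$ (k, i) * (if l = N - i then \<sigma> powi ((- 1) ^ i) else 0))"
    using assms by (simp add: quasi_refl_def scalar_prod_def)
  also have "\<dots> = (\<Sum>i\<in>{0..<N + 1}. if i = N - l then M $$ (k, i) * \<sigma> powi ((- 1) ^ i) else 0)"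
    using assms(3) by (intro sum.cong) auto
  finally show ?thesis by (simp add: sum.delta)
qed

lemma index_quasi_refl_conj:
  assumes "even N" and M: "M \<in> carrier_mat (N + 1) (N + 1)" and "k \<le> N" and "l \<le> N"
  shows "(quasi_refl N \<sigma> * M * quasi_refl N \<sigma>) $$ (k, l) =
    \<sigma> powi ((- 1) ^ k) * M $$ (N - k, N - l) * \<sigma> powi ((- 1) ^ l)"
proof -
  \<comment> \<open>For even \<open>N\<close>, reversing an index preserves its parity, so both
    sides of the conjugation follow the same rule.\<close>
  have "(- 1 :: int) ^ (N - l) = (- 1) ^ l"
    using assms by (simp add: minus_one_power_iff)
  then show ?thesis
    using assms
    by (simp add: index_mult_quasi_refl[OF mult_carrier_mat[OF quasi_refl_carrier M]]
      index_quasi_refl_mult[OF M])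
qed

lemma quasi_refl_inverse:
  assumes "even N" and "\<tau> \<noteq> 0"
  shows "quasi_refl N (inverse \<tau>) * quasi_refl N \<tau> = 1\<^sub>m (N + 1)"
proof (rule eq_matI)
  fix k l assume "k < dim_row (1\<^sub>m (N + 1) :: complex mat)" "l < dim_col (1\<^sub>m (N + 1) :: complex mat)"
  then have kl: "k \<le> N" "l \<le> N" by auto
  have "(quasi_refl N (inverse \<tau>) * quasi_refl N \<tau>) $$ (k, l) =
      inverse \<tau> powi ((- 1) ^ k) * quasi_refl N \<tau> $$ (N - k, l)"
    using kl by (intro index_quasi_refl_mult[OF quasi_refl_carrier]) auto
  also have "\<dots> = 1\<^sub>m (N + 1) $$ (k, l)"
    using assms kl by (auto simp: quasi_refl_def minus_one_power_iff power_int_minus)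
  finally show "(quasi_refl N (inverse \<tau>) * quasi_refl N \<tau>) $$ (k, l) = 1\<^sub>m (N + 1) $$ (k, l)" .
qed (simp_all add: quasi_refl_def)

section \<open>Mirror duality of the factors\<close>

lemma cmv_M2_mirror_dual:
  assumes "even N" and \<omega>: "cmod \<omega> = 1" and \<tau>: "\<tau>\<^sup>2 = \<omega>"
  shows "cmv_M2 N \<omega> (mirror_dual N \<omega> a) =
    quasi_refl N (inverse \<tau>) * cmv_M1 N a * quasi_refl N (inverse \<tau>)"
    (is "?L = ?R")
proof (rule eq_matI)
  have \<tau>0: "\<tau> \<noteq> 0" using \<omega> \<tau> by auto
  have cnj: "cnj \<omega> = inverse \<omega>"
    using \<omega> by (intro inverse_unique[symmetric]) (simp add: complex_norm_square[symmetric])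
  fix k l assume "k < dim_row ?R" "l < dim_col ?R"
  then have kl: "k \<le> N" "l \<le> N" by (simp_all add: quasi_refl_def)
  have parity: "even (N - k) \<longleftrightarrow> even k" "even (N - l) \<longleftrightarrow> even l"
    using assms(1) kl by auto
  have R: "?R $$ (k, l) =
      inverse \<tau> powi ((- 1) ^ k) * cmv_M1 N a $$ (N - k, N - l) * inverse \<tau> powi ((- 1) ^ l)"
    by (rule index_quasi_refl_conj) (use kl assms(1) cmv_M1_carrier in auto)
  have M1: "cmv_M1 N a $$ (N - k, N - l) =
    (if k = l then (if k = N then 1 else if odd k then cnj (a (N - k)) else - a (N - k - 1))
     else if odd k \<and> k = l + 1 then rho (a (N - k))
     else if odd l \<and> l = k + 1 then rho (a (N - l)) else 0)"
  proof -
    \<comment> \<open>Reversal exchanges the entries above and below the diagonal and sends the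
      corner \<open>0\<close> to \<open>N\<close>.\<close>
    have *: "N - k = N - l \<longleftrightarrow> k = l" "N - k = 0 \<longleftrightarrow> k = N"
      "N - l = N - k + 1 \<longleftrightarrow> k = l + 1" "N - k = N - l + 1 \<longleftrightarrow> l = k + 1"
      using kl by auto
    show ?thesis
      by (simp only: index_cmv_M1[OF assms(1) diff_le_self diff_le_self] * parity)
  qed
  have L: "?L $$ (k, l) =
    (if k = l then
       if k = N then inverse \<omega>
       else if even k then - inverse \<omega> * a (N - k - 1) else \<omega> * cnj (a (N - k))
     else if even k \<and> l = k + 1 then rho (a (N - l))
     else if even l \<and> k = l + 1 then rho (a (N - k)) else 0)"
  proof -
    \<comment> \<open>An odd row \<open>k\<close> is the second row of the block with coefficient
      index \<open>k - 1\<close>, whose mirror image is \<open>N - k\<close>; oddness excludes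
      \<open>k = 0\<close>, where \<open>k - 1\<close> would truncate.\<close>
    have "N - (k - 1) - 1 = N - k" if "odd k"
      using that kl by (cases k) auto
    moreover have rho_mirror: "rho (- (\<omega> * cnj z)) = rho z" for z
      using \<omega> by (simp add: rho_def norm_mult)
    ultimately show ?thesis
      using index_cmv_M2[OF assms(1) kl, of \<omega> "mirror_dual N \<omega> a"]
      by (auto simp: rho_mirror mirror_dual_def cnj)
  qed
  have pw: "inverse \<tau> powi ((- 1) ^ i) = (if even i then inverse \<tau> else \<tau>)" for i
    by (simp add: minus_one_power_iff power_int_minus)
  \<comment> \<open>Equal parities of row and column give a factor \<open>inverse \<omega>\<close>
    or \<open>\<omega>\<close>, as on the diagonal. Neighbouring indices have opposite parities, so
    the factors cancel and the \<open>rho\<close> entries are unchanged.\<close>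
  have conj: "inverse \<tau> * x * inverse \<tau> = inverse \<omega> * x" "\<tau> * x * \<tau> = \<omega> * x"
    "inverse \<tau> * x * \<tau> = x" "\<tau> * x * inverse \<tau> = x" for x
    using \<tau>0 by (simp_all add: power2_eq_square field_simps flip: \<tau>)
  show "?L $$ (k, l) = ?R $$ (k, l)"
    unfolding L R M1 pw
    by (cases "even k"; cases "even l") (simp_all only: conj if_True if_False, use assms(1) in auto)
qed (use assms cmv_M2_carrier[of N] in \<open>auto simp: quasi_refl_def\<close>)

text \<open>The two reversals cancel for indices below \<open>N\<close>, and the constants combine
  to \<open>\<omega> * cnj \<omega> = 1\<close>.\<close>

lemma mirror_dual_involutive:
  assumes "cmod \<omega> = 1" and "n < N"
  shows "mirror_dual N \<omega> (mirror_dual N \<omega> a) n = a n"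
proof -
  have "\<omega> * cnj \<omega> = 1"
    using assms(1) by (simp add: complex_norm_square[symmetric])
  then show ?thesis
    using assms(2) by (simp add: mirror_dual_def mult.assoc[symmetric])
qed

text \<open>Needed because the double mirror dual agrees with \<open>a\<close> only below
  \<open>N\<close>, not as a function.\<close>

lemma cmv_M2_cong:
  assumes "\<And>n. n < N \<Longrightarrow> a n = b n"
  shows "cmv_M2 N \<omega> a = cmv_M2 N \<omega> b"
proof -
  have "map (\<lambda>j. Theta (a (2 * j))) [0..<N div 2] = map (\<lambda>j. Theta (b (2 * j))) [0..<N div 2]"
    using assms by auto
  then show ?thesis
    by (simp only: cmv_M2_def)
qed

theorem proposition7p5:
  fixes N :: nat and \<omega> \<tau> :: complex and a :: "nat \<Rightarrow> complex"
  assumes "N \<ge> 2" and "even N"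
    and "cmod \<omega> = 1"
    and "\<And>n. n < N \<Longrightarrow> cmod (a n) < 1"
    and "\<tau>\<^sup>2 = \<omega>"
  shows "cmv_M2 N \<omega> (mirror_dual N \<omega> a)
           = quasi_refl N (inverse \<tau>) * cmv_M1 N a * quasi_refl N (inverse \<tau>)
           \<and> cmv_M1 N (mirror_dual N \<omega> a)
           = quasi_refl N \<tau> * cmv_M2 N \<omega> a * quasi_refl N \<tau>
           \<and> quasi_refl N \<tau> * cmv_U N \<omega> a * quasi_refl N (inverse \<tau>)
           = cmv_M1 N (mirror_dual N \<omega> a) * cmv_M2 N \<omega> (mirror_dual N \<omega> a)
           \<and> cmv_M1 N (mirror_dual N \<omega> a) * cmv_M2 N \<omega> (mirror_dual N \<omega> a)
           = transpose_mat (cmv_U N \<omega> (mirror_dual N \<omega> a))"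
proof -
  let ?b = "mirror_dual N \<omega> a"
  let ?Q = "quasi_refl N \<tau>" and ?R = "quasi_refl N (inverse \<tau>)"
  let ?C = "carrier_mat (N + 1) (N + 1) :: complex mat set"
  note ev = \<open>even N\<close>
  have \<tau>0: "\<tau> \<noteq> 0" using assms by auto
  have C: "?Q \<in> ?C" "?R \<in> ?C" "cmv_M1 N a \<in> ?C" "cmv_M2 N \<omega> a \<in> ?C"
    "cmv_M1 N ?b \<in> ?C" "cmv_M2 N \<omega> ?b \<in> ?C"
    by (rule quasi_refl_carrier cmv_M1_carrier[OF ev] cmv_M2_carrier[OF ev])+
  note assoc = assoc_mult_mat[of _ "N + 1" "N + 1" _ "N + 1" _ "N + 1"]
  note closed = mult_carrier_mat[of _ "N + 1" "N + 1" _ "N + 1"]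
  have RQ: "?R * ?Q = 1\<^sub>m (N + 1)"
    using quasi_refl_inverse[OF ev \<tau>0] .
  have QR: "?Q * ?R = 1\<^sub>m (N + 1)"
    using quasi_refl_inverse[OF ev, of "inverse \<tau>"] \<tau>0 by simp
  have cancel: "?Q * (?R * X) = X" "?R * (?Q * X) = X" if "X \<in> ?C" for X
    by (simp_all only: QR RQ left_mult_one_mat[OF that]
      assoc[OF C(1,2) that, symmetric] assoc[OF C(2,1) that, symmetric])
  have M2: "cmv_M2 N \<omega> ?b = ?R * cmv_M1 N a * ?R"
    by (rule cmv_M2_mirror_dual[OF ev assms(3,5)])
  \<comment> \<open>The first equation is applied to \<open>?b\<close> in place of \<open>a\<close>;
    multiplying by \<open>?Q\<close> on both sides then isolates \<open>cmv_M1 N ?b\<close>.\<close>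
  have "cmv_M2 N \<omega> a = cmv_M2 N \<omega> (mirror_dual N \<omega> ?b)"
    by (rule cmv_M2_cong) (simp add: mirror_dual_involutive[OF assms(3)])
  also have "\<dots> = ?R * cmv_M1 N ?b * ?R"
    by (rule cmv_M2_mirror_dual[OF ev assms(3,5)])
  finally have "?Q * cmv_M2 N \<omega> a * ?Q = ?Q * (?R * (cmv_M1 N ?b * (?R * ?Q)))"
    by (simp only: assoc closed C)
  then have M1: "cmv_M1 N ?b = ?Q * cmv_M2 N \<omega> a * ?Q"
    by (simp only: RQ cancel right_mult_one_mat[OF C(5)] C)
  \<comment> \<open>Between the two conjugated factors on the right stands \<open>?Q * ?R\<close>,
    which drops out and leaves only the outer pair.\<close>
  have "?Q * cmv_U N \<omega> a * ?R = cmv_M1 N ?b * cmv_M2 N \<omega> ?b"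
    unfolding M1 M2 cmv_U_def by (simp only: assoc closed cancel C)
  moreover have "cmv_M1 N ?b * cmv_M2 N \<omega> ?b = transpose_mat (cmv_U N \<omega> ?b)"
    using transpose_mult[OF C(6) C(5)] ev
    by (simp add: cmv_U_def transpose_cmv_M1 transpose_cmv_M2)
  ultimately show ?thesis
    using M1 M2 by (intro conjI)
qed

end
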